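(* Assume that $g\ge 0$ is a $C^1([0,\infty))$ function satisfying $$\dot g(t)\le -a(t)f(g(t))+b(t)\quad (t\ge 0),\qquad g(0)=g_0,$$ where $f\ge 0$ is a non-decreasing continuous function on $[0,\infty)$, $f(0)=0$, $f(t)>0$ if $t>0$, $a(t)>0$ and $b(t)\ge 0$ are continuous functions on $[0,\infty)$, and there exists a constant $C>0$ such that $$\lim_{t\to\infty}\Big(t-\frac{C}{a(t)}\Big)=\infty,\qquad \limsup_{t\to\infty}\frac{\max_{\xi\in[t-\frac{C}{a(t)},\,t]}a(\xi)}{\min_{\xi\in[t-\frac{C}{a(t)},\,t]}a(\xi)}<\infty.$$ If $$K:=\limsup_{t\to\infty}\frac{b(t)}{a(t)}<\infty,\qquad \int_0^\infty b(s)\,ds<\infty,$$ then $$\lim_{t\to\infty}g(t)=0.$$ *)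

theory Defs
  imports "HOL-Analysis.Analysis"
begin

end

theory Submission
  imports Defs
begin

text \<open>
  Write \<open>B\<close> for the primitive of \<open>b\<close> that vanishes at \<open>0\<close>. Since \<open>g' - b \<le> - a f(g) \<le> 0\<close>, the function
  \<open>g - B\<close> is non-increasing; it is bounded below because \<open>g \<ge> 0\<close> and \<open>B\<close> stays below the
  finite integral of \<open>b\<close>. So \<open>g - B\<close> converges, \<open>B\<close> converges, and therefore \<open>g\<close> has a
  limit \<open>L \<ge> 0\<close>.

  Suppose \<open>L > 0\<close>. Eventually \<open>g \<ge> L/2\<close>, hence \<open>f(g) \<ge> f(L/2) > 0\<close>. Consider the window
  from \<open>t - C/a(t)\<close> to \<open>t\<close>. If \<open>M\<close> bounds the ratio of maximum to minimum of \<open>a\<close> there for all late \<open>t\<close>, then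
  \<open>a \<ge> a(t)/M\<close> on the window, and since its length is \<open>C/a(t)\<close>, the mean value
  theorem makes \<open>g - B\<close> drop across it by at least \<open>(C/a(t)) (a(t)/M) f(L/2) = C f(L/2)/M\<close>, an
  amount independent of \<open>t\<close>. Both ends of the window tend to infinity, so the drop must
  also tend to \<open>0\<close>: a contradiction. In effect, the hypotheses on \<open>a\<close> enter
  because they prevent \<open>a\<close> from being integrable.
\<close>

lemma increment_le_of_deriv_le:
  fixes h h' :: "real \<Rightarrow> real"
  assumes "s \<le> t"
    and deriv: "\<And>x. x \<in> {s..t} \<Longrightarrow> (h has_real_derivative h' x) (at x within {s..t})"
    and bound: "\<And>x. x \<in> {s..t} \<Longrightarrow> h' x \<le> m"
  shows "h t - h s \<le> m * (t - s)"
proof -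
  obtain x where x: "x \<in> {s..t}" and eq: "h t - h s = h' x * (t - s)"
    using mvt_very_simple[OF \<open>s \<le> t\<close>, of h "\<lambda>x y. h' x * y"] deriv
    by (auto simp: has_field_derivative_def)
  show ?thesis
    unfolding eq using bound[OF x] \<open>s \<le> t\<close> by (intro mult_right_mono) auto
qed

lemma antimono_on_bounded_below_tendsto:
  fixes h :: "real \<Rightarrow> real"
  assumes anti: "\<And>x y. c \<le> x \<Longrightarrow> x \<le> y \<Longrightarrow> h y \<le> h x"
    and lower: "\<And>x. c \<le> x \<Longrightarrow> m \<le> h x"
  obtains l where "(h \<longlongrightarrow> l) at_top"
proof
  have bdd: "bdd_below (h ` {c..})"
    using lower by (intro bdd_belowI[where m = m]) auto
  show "(h \<longlongrightarrow> Inf (h ` {c..})) at_top"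
  proof (rule decreasing_tendsto)
    show "\<forall>\<^sub>F x in at_top. Inf (h ` {c..}) \<le> h x"
      using eventually_ge_at_top[of c] by eventually_elim (auto intro: cInf_lower bdd)
  next
    fix y assume "Inf (h ` {c..}) < y"
    then obtain z where z: "c \<le> z" "h z < y"
      using cInf_less_iff[OF _ bdd] by auto
    show "\<forall>\<^sub>F x in at_top. h x < y"
      using eventually_ge_at_top[of z]
    proof eventually_elim
      case (elim x)
      then show ?case using anti[OF z(1) elim] z(2) by linarith
    qed
  qed
qed

text \<open>
  Finiteness of the Lebesgue integral is turned into convergence of the Henstock--Kurzweil
  primitive: the primitive is non-decreasing, and each of its values is the integral over
  an initial segment.
\<close>

lemma convergent_primitive:
  fixes b :: "real \<Rightarrow> real"
  assumes cont: "continuous_on {0..} b" and nonneg: "\<forall>t\<ge>0. b t \<ge> 0"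
    and fin: "(\<integral>\<^sup>+s\<in>{0..}. ennreal (b s) \<partial>lborel) < \<infinity>"
  obtains B u l where
    "\<forall>t\<ge>0. (B has_real_derivative b t) (at t within {0..})"
    "\<forall>t\<ge>0. B t \<le> u" "(B \<longlongrightarrow> l) at_top"
proof -
  define B where "B t = integral {0..t} b" for t
  define I where "I = (\<integral>\<^sup>+s\<in>{0..}. ennreal (b s) \<partial>lborel)"
  have deriv: "(B has_real_derivative b t) (at t within {0..})" if "0 \<le> t" for t
  proof -
    have "((\<lambda>x. integral {0..x} b) has_real_derivative b t) (at t within {0..t + 1})"
      using that by (intro integral_has_real_derivative continuous_on_subset[OF cont]) auto
    moreover have "at t within {0..t + 1} = at t within {0..}"
      by (rule at_within_nhd[of t "{..<t + 1}"]) auto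
    ultimately show ?thesis by (simp add: B_def[abs_def])
  qed
  have upper: "B t \<le> enn2real I" if "0 \<le> t" for t
  proof -
    have "b integrable_on {0..t}"
      by (intro integrable_continuous_real continuous_on_subset[OF cont]) auto
    then have int: "(b has_integral B t) {0..t}"
      unfolding B_def by (rule integrable_integral)
    have "ennreal (B t) = (\<integral>\<^sup>+s\<in>{0..t}. ennreal (b s) \<partial>lborel)"
      using nn_integral_has_integral_lebesgue'[OF _ int] nonneg by auto
    also have "\<dots> \<le> I"
      unfolding I_def by (intro nn_integral_mono) (auto simp: indicator_def)
    finally have "enn2real (ennreal (B t)) \<le> enn2real I"
      using fin by (intro enn2real_mono) (auto simp: I_def)
    moreover have "0 \<le> B t"
      using has_integral_nonneg[OF int] nonneg by auto
    ultimately show ?thesis by simp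
  qed
  have mono: "- B y \<le> - B x" if "0 \<le> x" "x \<le> y" for x y
  proof -
    have neg_deriv: "((\<lambda>t. - B t) has_real_derivative - b t) (at t within {x..y})" if "t \<in> {x..y}" for t
      by (intro DERIV_minus DERIV_subset[OF deriv]) (use that \<open>0 \<le> x\<close> in auto)
    have neg_le: "- b t \<le> 0" if "t \<in> {x..y}" for t
      using that \<open>0 \<le> x\<close> nonneg by auto
    from increment_le_of_deriv_le[OF \<open>x \<le> y\<close> neg_deriv neg_le] show ?thesis
      by simp
  qed
  obtain l where "((\<lambda>t. - B t) \<longlongrightarrow> l) at_top"
    by (rule antimono_on_bounded_below_tendsto[of 0 "\<lambda>t. - B t" "- enn2real I", OF mono])
      (use upper in auto)
  from tendsto_minus[OF this] have "(B \<longlongrightarrow> - l) at_top"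
    by simp
  with deriv upper show ?thesis by (intro that) auto
qed

text \<open>
  On a compact interval the two description operators denote the attained maximum and
  minimum of \<open>a\<close>, so a bound on their quotient is a Harnack-type comparison of the values.
\<close>

lemma le_mult_if_Greatest_div_Least_less:
  fixes a :: "real \<Rightarrow> real"
  assumes cont: "continuous_on {s..t} a" and pos: "\<And>x. x \<in> {s..t} \<Longrightarrow> 0 < a x"
    and ratio: "(GREATEST y. y \<in> a ` {s..t}) / (LEAST y. y \<in> a ` {s..t}) < M"
    and x: "x \<in> {s..t}" and y: "y \<in> {s..t}"
  shows "a x \<le> M * a y"
proof -
  have ne: "{s..t} \<noteq> {}" using x by auto
  obtain p where p: "p \<in> {s..t}" "\<And>z. z \<in> {s..t} \<Longrightarrow> a z \<le> a p"
    using continuous_attains_sup[OF compact_Icc ne cont] by blast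
  obtain q where q: "q \<in> {s..t}" "\<And>z. z \<in> {s..t} \<Longrightarrow> a q \<le> a z"
    using continuous_attains_inf[OF compact_Icc ne cont] by blast
  have "(GREATEST y. y \<in> a ` {s..t}) = a p"
    by (rule Greatest_equality) (use p in auto)
  moreover have "(LEAST y. y \<in> a ` {s..t}) = a q"
    by (rule Least_equality) (use q in auto)
  ultimately have "a p / a q < M" using ratio by simp
  then have "a p < M * a q"
    using pos[OF q(1)] by (simp add: pos_divide_less_eq)
  moreover have "0 < M"
    using \<open>a p / a q < M\<close> divide_pos_pos[OF pos[OF p(1)] pos[OF q(1)]] by linarith
  moreover have "M * a q \<le> M * a y"
    using q(2)[OF y] \<open>0 < M\<close> by simp
  ultimately show ?thesis using p(2)[OF x] by linarith
qed

theorem theorem2p14: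
  fixes g g' f a b :: "real \<Rightarrow> real" and g0 C :: real and K :: ereal
  assumes g_nonneg: "\<forall>t\<ge>0. g t \<ge> 0"
    and g_deriv: "\<forall>t\<ge>0. (g has_real_derivative g' t) (at t within {0..})"
    and g'_cont: "continuous_on {0..} g'"
    and g_ineq: "\<forall>t\<ge>0. g' t \<le> - a t * f (g t) + b t"
    and g_init: "g 0 = g0"
    and f_nonneg: "\<forall>t\<ge>0. f t \<ge> 0"
    and f_mono: "mono_on {0..} f"
    and f_cont: "continuous_on {0..} f"
    and f_zero: "f 0 = 0"
    and f_pos: "\<forall>t>0. f t > 0"
    and a_pos: "\<forall>t\<ge>0. a t > 0"
    and a_cont: "continuous_on {0..} a"
    and b_nonneg: "\<forall>t\<ge>0. b t \<ge> 0"
    and b_cont: "continuous_on {0..} b"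
    and C_pos: "C > 0"
    and C_lim: "filterlim (\<lambda>t. t - C / a t) at_top at_top"
    and C_limsup: "Limsup at_top (\<lambda>t. ereal
          ((GREATEST y. y \<in> a ` {t - C / a t..t}) / (LEAST y. y \<in> a ` {t - C / a t..t}))) < \<infinity>"
    and K_def: "K = Limsup at_top (\<lambda>t. ereal (b t / a t))"
    and K_fin: "K < \<infinity>"
    and b_int: "(\<integral>\<^sup>+s\<in>{0..}. ennreal (b s) \<partial>lborel) < \<infinity>"
  shows "(g \<longlongrightarrow> 0) at_top"
proof -
  obtain B u lB where
    B_deriv: "\<forall>t\<ge>0. (B has_real_derivative b t) (at t within {0..})"
    and B_upper: "\<forall>t\<ge>0. B t \<le> u" and B_lim: "(B \<longlongrightarrow> lB) at_top"
    using convergent_primitive[OF b_cont b_nonneg b_int] by blast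
  define h where "h t = g t - B t" for t
  have h_deriv: "(h has_real_derivative (g' x - b x)) (at x within {s..t})"
    if "0 \<le> s" "x \<in> {s..t}" for s t x
  proof -
    have "(h has_real_derivative (g' x - b x)) (at x within {0..})"
      unfolding h_def[abs_def] using that g_deriv B_deriv by (intro DERIV_diff) auto
    then show ?thesis by (rule DERIV_subset) (use that in auto)
  qed
  have slope: "g' x - b x \<le> - (a x * f (g x))" if "0 \<le> x" for x
    using g_ineq that by force
  have h_anti: "h t \<le> h s" if "0 \<le> s" "s \<le> t" for s t
  proof -
    have "g' x - b x \<le> 0" if "x \<in> {s..t}" for x
    proof -
      have "0 \<le> x" using that \<open>0 \<le> s\<close> by simp
      then have "0 \<le> a x * f (g x)"
        using a_pos f_nonneg g_nonneg by (simp add: less_imp_le)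
      then show ?thesis using slope[OF \<open>0 \<le> x\<close>] by linarith
    qed
    from increment_le_of_deriv_le[OF \<open>s \<le> t\<close> h_deriv[OF \<open>0 \<le> s\<close>] this] show ?thesis
      by simp
  qed
  have h_lower: "- u \<le> h t" if "0 \<le> t" for t
    using g_nonneg B_upper that by (force simp: h_def)
  obtain lh where h_lim: "(h \<longlongrightarrow> lh) at_top"
    by (rule antimono_on_bounded_below_tendsto[OF h_anti h_lower])
  define L where "L = lh + lB"
  have g_lim: "(g \<longlongrightarrow> L) at_top"
    using tendsto_add[OF h_lim B_lim] by (simp add: h_def L_def)
  have "0 \<le> L"
  proof (rule tendsto_lowerbound[OF g_lim])
    show "\<forall>\<^sub>F t in at_top. 0 \<le> g t"
      using eventually_ge_at_top[of "0::real"] by eventually_elim (use g_nonneg in auto)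
  qed simp
  moreover have "\<not> 0 < L"
  proof
    assume "0 < L"
    define \<delta> where "\<delta> = f (L / 2)"
    have "0 < \<delta>" using f_pos \<open>0 < L\<close> by (simp add: \<delta>_def)
    obtain T where T: "\<And>t. T \<le> t \<Longrightarrow> L / 2 < g t"
      using order_tendstoD(1)[OF g_lim, of "L / 2"] \<open>0 < L\<close>
      by (auto simp: eventually_at_top_linorder)
    have f_lower: "\<delta> \<le> f (g t)" if "T \<le> t" for t
      unfolding \<delta>_def using T[OF that] \<open>0 < L\<close> by (intro mono_onD[OF f_mono]) auto
    obtain M0 where "Limsup at_top (\<lambda>t. ereal
        ((GREATEST y. y \<in> a ` {t - C / a t..t}) / (LEAST y. y \<in> a ` {t - C / a t..t}))) < ereal M0"
      using ereal_dense2[OF C_limsup] by blast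
    \<comment> \<open>Enlarging the bound makes its positivity immediate; the drop estimate divides by it.\<close>
    then obtain M where "0 < M" and M: "Limsup at_top (\<lambda>t. ereal
        ((GREATEST y. y \<in> a ` {t - C / a t..t}) / (LEAST y. y \<in> a ` {t - C / a t..t}))) < ereal M"
      by (intro that[of "max 1 M0"]) (auto elim: less_le_trans)
    \<comment> \<open>Asking \<open>t - C / a t > max 0 T\<close> keeps the whole window inside the half-line where the hypotheses
        hold and where \<open>g\<close> already exceeds \<open>L / 2\<close>.\<close>
    have drop: "\<forall>\<^sub>F t in at_top. h t - h (t - C / a t) \<le> - (C * \<delta> / M)"
      using Limsup_lessD[OF M] filterlim_at_top_dense[THEN iffD1, rule_format, OF C_lim, of "max 0 T"]
        eventually_ge_at_top[of 0]
    proof eventually_elim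
      case (elim t)
      define s where "s = t - C / a t"
      have at: "0 < a t" and "s \<le> t" and "0 \<le> s" and "T \<le> s"
        using elim a_pos C_pos by (auto simp: s_def)
      have pos: "0 < a x" if "x \<in> {s..t}" for x
        using that \<open>0 \<le> s\<close> a_pos by auto
      have cont: "continuous_on {s..t} a"
        using \<open>0 \<le> s\<close> by (intro continuous_on_subset[OF a_cont]) auto
      have ratio: "(GREATEST y. y \<in> a ` {s..t}) / (LEAST y. y \<in> a ` {s..t}) < M"
        using elim(1) by (simp add: s_def)
      have compare: "a t \<le> M * a x" if "x \<in> {s..t}" for x
        using le_mult_if_Greatest_div_Least_less[OF cont pos ratio _ that] \<open>s \<le> t\<close> by auto
      have "g' x - b x \<le> - (a t / M * \<delta>)" if "x \<in> {s..t}" for x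
      proof -
        have "a t / M \<le> a x"
          using compare[OF that] \<open>0 < M\<close> by (simp add: pos_divide_le_eq mult.commute)
        then have "a t / M * \<delta> \<le> a x * f (g x)"
          using f_lower[of x] that \<open>T \<le> s\<close> \<open>0 < \<delta>\<close> pos[OF that] by (intro mult_mono) auto
        then show ?thesis using slope[of x] that \<open>0 \<le> s\<close> by auto
      qed
      from increment_le_of_deriv_le[OF \<open>s \<le> t\<close> h_deriv[OF \<open>0 \<le> s\<close>] this]
      have "h t - h s \<le> - (a t / M * \<delta>) * (t - s)" .
      also have "\<dots> = - (C * \<delta> / M)"
        using at by (simp add: s_def)
      finally show ?case by (simp add: s_def)
    qed
    have "((\<lambda>t. h t - h (t - C / a t)) \<longlongrightarrow> lh - lh) at_top"
      by (intro tendsto_diff h_lim filterlim_compose[OF h_lim C_lim])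
    from tendsto_upperbound[OF this drop] have "0 \<le> - (C * \<delta> / M)" by simp
    moreover have "0 < C * \<delta> / M"
      using C_pos \<open>0 < \<delta>\<close> \<open>0 < M\<close> by simp
    ultimately show False by linarith
  qed
  ultimately show ?thesis using g_lim by simp
qed

end
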